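(* Let $B = B(F)$ be the stationary generalized Bratteli diagram defined by the symmetric tridiagonal matrix $$F =\begin{pmatrix}2&1&0&0&\cdots\\1&3&1&0&\cdots\\0&1&4&1&\cdots\\0&0&1&5&\ddots\\\vdots&\vdots&\vdots&\ddots&\ddots\end{pmatrix},$$ i.e. $F=(f_{ij})_{i,j\ge 1}$ with $f_{ii}=i+1$, $f_{ij}=1$ if $|i-j|=1$, and $f_{ij}=0$ otherwise. Then there is no tail invariant probability measure on the path space $X_B$.
   Context: A generalized Bratteli diagram $B=(V,E)$ is a graded graph with vertex set $V=\bigsqcup_{n\ge 0}V_n$ and edge set $E=\bigsqcup_{n\ge 0}E_n$, where every $V_n$ is countably infinite, each edge $e\in E_n$ has a source $s(e)\in V_n$ and a range $r(e)\in V_{n+1}$ (multiple edges are allowed), $s^{-1}(v)\neq\emptyset$ for every $v\in V$, and $r^{-1}(v)$ is nonempty and finite for every $v\in V\setminus V_0$. The incidence matrices are $F_n=(f^{(n)}_{v,w})_{v\in V_{n+1},\,w\in V_n}$, where $f^{(n)}_{v,w}$ is the number of edges from $w\in V_n$ to $v\in V_{n+1}$. The diagram is stationary, written $B=B(F)$, if all $V_n$ are identified with one set (here $V_n=\mathbb N=\{1,2,\dots\}$) and $F_n=F$ for all $n\ge 0$. The path space $X_B$ is the set of infinite edge sequences $(x_0,x_1,\dots)$ with $x_i\in E_i$ and $r(x_i)=s(x_{i+1})$ for all $i$ (so paths start in $V_0$). For a finite path $\overline e=(e_0,\dots,e_n)$ starting in $V_0$, set $r(\overline e)=r(e_n)$,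 and let $[\overline e]=\{x\in X_B: x_i=e_i,\ 0\le i\le n\}$ be the associated cylinder set; cylinder sets form a base of clopen sets of the (Polish, zero-dimensional) topology of $X_B$. A Borel measure $\mu$ on $X_B$ is tail invariant if $\mu([\overline e])=\mu([\overline e'])$ whenever $\overline e,\overline e'$ are finite paths starting at level $0$ with $r(\overline e)=r(\overline e')$. *)

theory Defs
  imports "HOL-Probability.Probability"
begin

text \<open>
  The vertex set and the edge set of a diagram are disjoint unions of their levels. A diagram is
  given by the families of its levels, and the level index plays the role of the tag of the
  disjoint union: as a vertex of the diagram, \<open>v \<in> verts B n\<close> is the pair \<open>(n, v)\<close>, and likewise
  for edges. The sets \<open>verts B n\<close> need not be disjoint, which allows all levels to be identified
  with one set. The edge \<open>e\<close> of level \<open>n\<close> goes from \<open>(n, src B n e)\<close> to \<open>(n + 1, rng B n e)\<close>.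
\<close>

record ('v, 'e) diagram =
  verts :: "nat \<Rightarrow> 'v set"
  edges :: "nat \<Rightarrow> 'e set"
  src :: "nat \<Rightarrow> 'e \<Rightarrow> 'v"
  rng :: "nat \<Rightarrow> 'e \<Rightarrow> 'v"

definition generalized_bratteli :: "('v, 'e) diagram \<Rightarrow> bool" where
  "generalized_bratteli B \<longleftrightarrow>
     (\<forall>n. countable (verts B n) \<and> infinite (verts B n)) \<and>
     (\<forall>n. \<forall>e\<in>edges B n. src B n e \<in> verts B n \<and> rng B n e \<in> verts B (Suc n)) \<and>
     (\<forall>n. \<forall>v\<in>verts B n. {e \<in> edges B n. src B n e = v} \<noteq> {}) \<and>
     (\<forall>n. \<forall>v\<in>verts B (Suc n).
        {e \<in> edges B n. rng B n e = v} \<noteq> {} \<and> finite {e \<in> edges B n. rng B n e = v})"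

definition incidence :: "('v, 'e) diagram \<Rightarrow> nat \<Rightarrow> 'v \<Rightarrow> 'v \<Rightarrow> nat" where
  "incidence B n v w = card {e \<in> edges B n. src B n e = w \<and> rng B n e = v}"

text \<open>
  \<open>B = B(F)\<close>, with every level identified with the positive integers. The matrix \<open>F\<close> determines
  the diagram up to the naming of its edges; the predicate holds for every choice of names.
\<close>

definition is_stationary_diagram :: "(nat, 'e) diagram \<Rightarrow> (nat \<Rightarrow> nat \<Rightarrow> nat) \<Rightarrow> bool" where
  "is_stationary_diagram B F \<longleftrightarrow>
     generalized_bratteli B \<and>
     (\<forall>n. verts B n = {1..}) \<and>
     (\<forall>n. \<forall>v\<in>{1..}. \<forall>w\<in>{1..}. incidence B n v w = F v w)"

definition path_space :: "('v, 'e) diagram \<Rightarrow> (nat \<Rightarrow> 'e) set" where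
  "path_space B = {x. \<forall>i. x i \<in> edges B i \<and> rng B i (x i) = src B (Suc i) (x (Suc i))}"

text \<open>A finite path starting in level 0 is the nonempty list of its edges.\<close>

definition finite_path :: "('v, 'e) diagram \<Rightarrow> 'e list \<Rightarrow> bool" where
  "finite_path B p \<longleftrightarrow>
     p \<noteq> [] \<and>
     (\<forall>i<length p. p ! i \<in> edges B i) \<and>
     (\<forall>i. Suc i < length p \<longrightarrow> rng B i (p ! i) = src B (Suc i) (p ! Suc i))"

text \<open>
  The range of a finite path is a vertex of the disjoint union of the levels, so it records the
  level: paths of different lengths never have the same range.
\<close>

definition path_range :: "('v, 'e) diagram \<Rightarrow> 'e list \<Rightarrow> nat \<times> 'v" where
  "path_range B p = (length p, rng B (length p - 1) (last p))"

definition cylinder :: "('v, 'e) diagram \<Rightarrow> 'e list \<Rightarrow> (nat \<Rightarrow> 'e) set" where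
  "cylinder B p = {x \<in> path_space B. \<forall>i<length p. x i = p ! i}"

definition path_topology :: "('v, 'e) diagram \<Rightarrow> (nat \<Rightarrow> 'e) topology" where
  "path_topology B = topology_generated_by {cylinder B p | p. finite_path B p}"

definition path_borel :: "('v, 'e) diagram \<Rightarrow> (nat \<Rightarrow> 'e) measure" where
  "path_borel B = sigma (path_space B) {U. openin (path_topology B) U}"

definition tail_invariant :: "('v, 'e) diagram \<Rightarrow> (nat \<Rightarrow> 'e) measure \<Rightarrow> bool" where
  "tail_invariant B \<mu> \<longleftrightarrow>
     sets \<mu> = sets (path_borel B) \<and>
     (\<forall>p q. finite_path B p \<and> finite_path B q \<and> path_range B p = path_range B q \<longrightarrow>
        emeasure \<mu> (cylinder B p) = emeasure \<mu> (cylinder B q))"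

definition tridiag :: "nat \<Rightarrow> nat \<Rightarrow> nat" where
  "tridiag i j = (if i = j then i + 1 else if i = j + 1 \<or> j = i + 1 then 1 else 0)"

lemma topspace_path_topology: "topspace (path_topology B) = path_space B"
proof -
  have "\<exists>p. x \<in> cylinder B p \<and> finite_path B p" if "x \<in> path_space B" for x
    using that by (intro exI[of _ "[x 0]"]) (auto simp: cylinder_def finite_path_def path_space_def)
  moreover have "cylinder B p \<subseteq> path_space B" for p
    by (auto simp: cylinder_def)
  ultimately show ?thesis
    unfolding path_topology_def topology_generated_by_topspace by blast
qed

text \<open>A diagram \<open>B(F)\<close> for the tridiagonal matrix exists.\<close>

lemma ex_stationary_tridiag:
  "\<exists>B :: (nat, nat \<times> nat \<times> nat) diagram. is_stationary_diagram B tridiag"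
proof -
  define E :: "(nat \<times> nat \<times> nat) set"
    where "E = {(w, v, k). 1 \<le> w \<and> 1 \<le> v \<and> k < tridiag v w}"
  define B :: "(nat, nat \<times> nat \<times> nat) diagram"
    where "B = \<lparr>verts = \<lambda>n. {1..}, edges = \<lambda>n. E, src = \<lambda>n e. fst e, rng = \<lambda>n e. fst (snd e)\<rparr>"
  have loop: "(v, v, 0) \<in> E" if "1 \<le> v" for v
    using that by (simp add: E_def tridiag_def)
  have fin: "finite {e \<in> E. fst (snd e) = v}" for v
  proof (rule finite_subset)
    show "{e \<in> E. fst (snd e) = v} \<subseteq> {..v + 1} \<times> {v} \<times> {..v + 1}"
      by (auto simp: E_def tridiag_def split: if_splits)
  qed auto
  have gb: "generalized_bratteli B"
    unfolding generalized_bratteli_def B_def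
    using fin loop by (fastforce simp: E_def infinite_Ici)
  have card: "card {e \<in> E. fst e = w \<and> fst (snd e) = v} = tridiag v w" if "1 \<le> v" "1 \<le> w" for v w
  proof -
    have "{e \<in> E. fst e = w \<and> fst (snd e) = v} = (\<lambda>k. (w, v, k)) ` {..<tridiag v w}"
      using that by (auto simp: E_def)
    then show ?thesis
      by (simp add: card_image inj_on_def)
  qed
  have "is_stationary_diagram B tridiag"
    using gb card unfolding is_stationary_diagram_def incidence_def by (simp add: B_def)
  then show ?thesis ..
qed

end

theory Submission
  imports Defs
begin

text \<open>
  Let \<open>\<mu>\<close> be a tail invariant probability measure and let \<open>a n v\<close> be the measure of a cylinder of
  \<open>n + 1\<close> edges that ends at the vertex \<open>v\<close>. Splitting a cylinder by the next edge gives
  \<open>a n = F (a (n + 1))\<close>, because \<open>F\<close> is symmetric. So \<open>a\<close> is a backward orbit of nonnegative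
  vectors under \<open>F\<close>. It is summable at level 0, since the loops at distinct vertices of \<open>V\<^sub>0\<close> have
  disjoint cylinders of total measure at most 1, and it is not zero, since the countably many
  one-edge cylinders cover the path space.

  Such an orbit cannot exist, because its decay would have two contradictory rates.

  On the one hand, \<open>F\<close> is symmetric, so the inner product of \<open>a m\<close> and \<open>a n\<close> depends only on
  \<open>m + n\<close>. By the Cauchy--Schwarz inequality the squared norms of the rows \<open>a n\<close> form a
  log-convex sequence; hence they are bounded below by a geometric sequence with positive ratio
  (\<open>row_product_lower\<close>).

  On the other hand, all terms of \<open>a n = F (a (n + 1))\<close> are nonnegative. The off-diagonal terms give
  \<open>a (n + 1) i \<le> a n (i + 1)\<close>: mass at a vertex can be charged to a vertex further to the right,
  one level earlier. The diagonal terms give \<open>a (n + 1) i \<le> a n i / d i\<close>. Moving first \<open>k\<close> places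
  to the right, where all diagonal entries exceed a given \<open>R\<close>, and then using the diagonal at all
  remaining levels bounds \<open>a n\<close> by a multiple of \<open>(1 / R) ^ (n - k)\<close> (\<open>row_product_upper\<close>). As \<open>R\<close> is arbitrary, the
  decay is faster than geometric.

  In spectral terms, \<open>a n\<close> normalised would converge to a nonnegative square-summable eigenvector
  of \<open>F\<close>, and the unbounded diagonal excludes such eigenvectors; the two rates replace this
  argument by elementary inequalities.
\<close>

section \<open>Backward orbits of Jacobi matrices\<close>

text \<open>
  The matrix has diagonal \<open>d 1, d 2, \<dots>\<close> and off-diagonal entries 1. Index 0 lies outside the matrix:
  the value 0 there lets the first row have the same form as all the others.
\<close>

locale jacobi_backward_orbit =
  fixes d :: "nat \<Rightarrow> real" and a :: "nat \<Rightarrow> nat \<Rightarrow> real"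
  assumes diag_nonneg: "\<And>i. 0 \<le> d i"
    and diag_tends: "filterlim d at_top sequentially"
    and nonneg: "\<And>n i. 0 \<le> a n i"
    and boundary: "\<And>n. a n 0 = 0"
    and backward: "\<And>n i. a n (Suc i) = a (Suc n) i + d (Suc i) * a (Suc n) (Suc i) + a (Suc n) (Suc (Suc i))"
    and summable_start: "summable (a 0)"
begin

text \<open>Repeated use of the off-diagonal entry that links \<open>i\<close> at one level to \<open>i + 1\<close> at the previous.\<close>

lemma shift_le: "a (n + k) i \<le> a n (i + k)"
proof (induction k arbitrary: i)
  case (Suc k)
  have "a (Suc (n + k)) i \<le> a (n + k) (Suc i)"
    using backward[of "n + k" i] nonneg diag_nonneg[of "Suc i"] by simp
  also have "\<dots> \<le> a n (Suc i + k)" by (rule Suc.IH)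
  finally show ?case by simp
qed simp

lemma diag_le: "d i * a (Suc n) i \<le> a n i"
  using backward[of n "i - 1"] boundary[of "Suc n"] boundary[of n] nonneg
  by (cases i) simp_all

lemma diag_power_le:
  assumes "0 \<le> R" "R \<le> d i"
  shows "R ^ n * a n i \<le> a 0 i"
proof (induction n)
  case (Suc n)
  have "R * a (Suc n) i \<le> a n i"
    using diag_le[of i n] mult_right_mono[OF assms(2) nonneg[of "Suc n" i]] by linarith
  then have "R ^ n * (R * a (Suc n) i) \<le> R ^ n * a n i"
    using assms(1) by (intro mult_left_mono) auto
  with Suc show ?case by (simp add: mult_ac)
qed simp

lemma summable_row: "summable (a n)"
proof (rule summable_comparison_test')
  show "summable (\<lambda>i. a 0 (i + n))"
    using summable_start by (simp add: summable_iff_shift)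
  show "norm (a n i) \<le> a 0 (i + n)" for i
    using shift_le[of 0 n i] nonneg[of n i] by simp
qed

lemma summable_row_product: "summable (\<lambda>i. a m i * a n i)"
proof (rule summable_comparison_test')
  show "summable (\<lambda>i. suminf (a m) * a n i)"
    by (intro summable_mult summable_row)
  have "a m i \<le> suminf (a m)" for i
    using sum_le_suminf[OF summable_row[of m], of "{i}"] nonneg by simp
  then show "norm (a m i * a n i) \<le> suminf (a m) * a n i" for i
    using nonneg by (simp add: mult_right_mono)
qed

definition row_product :: "nat \<Rightarrow> nat \<Rightarrow> real" where
  "row_product m n = (\<Sum>i. a m i * a n i)"

text \<open>
  Expanding \<open>a m = F (a (m + 1))\<close> and reindexing gives the quadratic form of \<open>F\<close> at the rows
  \<open>m + 1\<close> and \<open>n + 1\<close>, written so that its symmetry in these two rows is visible. Each of the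
  three series is dominated by the series on the left, so that rearranging is legitimate although
  \<open>F\<close> is unbounded.
\<close>

lemma row_product_backward:
  "row_product m (Suc n) =
     (\<Sum>i. a (Suc m) i * a (Suc n) (Suc i)) + (\<Sum>i. d i * (a (Suc m) i * a (Suc n) i)) +
     (\<Sum>i. a (Suc n) i * a (Suc m) (Suc i))"
proof -
  let ?x = "a (Suc m)" and ?y = "a (Suc n)"
  have total: "summable (\<lambda>i. a m (Suc i) * ?y (Suc i))"
    using summable_row_product[of m "Suc n"] by (subst summable_Suc_iff)
  have split: "a m (Suc i) * ?y (Suc i) =
      ?x i * ?y (Suc i) + d (Suc i) * (?x (Suc i) * ?y (Suc i)) + ?y (Suc i) * ?x (Suc (Suc i))" for i
    by (simp add: backward[of m i] algebra_simps)
  have nn: "0 \<le> ?x i * ?y (Suc i)" "0 \<le> d (Suc i) * (?x (Suc i) * ?y (Suc i))"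
      "0 \<le> ?y (Suc i) * ?x (Suc (Suc i))" for i
    using nonneg diag_nonneg by simp_all
  have 1: "summable (\<lambda>i. ?x i * ?y (Suc i))"
    by (rule summable_comparison_test'[OF total]) (use nn split in \<open>simp del: mult_eq_0_iff add: abs_of_nonneg\<close>)
  have 2: "summable (\<lambda>i. d (Suc i) * (?x (Suc i) * ?y (Suc i)))"
    by (rule summable_comparison_test'[OF total]) (use nn split in \<open>simp only: real_norm_def abs_of_nonneg, simp\<close>)
  have 3: "summable (\<lambda>i. ?y (Suc i) * ?x (Suc (Suc i)))"
    by (rule summable_comparison_test'[OF total]) (use nn split in \<open>simp only: real_norm_def abs_of_nonneg, simp\<close>)
  have "row_product m (Suc n) = (\<Sum>i. a m (Suc i) * ?y (Suc i))"
    unfolding row_product_def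
    using suminf_split_head[OF summable_row_product[of m "Suc n"]] boundary by simp
  also have "\<dots> = (\<Sum>i. ?x i * ?y (Suc i)) + (\<Sum>i. d (Suc i) * (?x (Suc i) * ?y (Suc i))) +
      (\<Sum>i. ?y (Suc i) * ?x (Suc (Suc i)))"
    unfolding split by (simp only: suminf_add[OF summable_add[OF 1 2] 3, symmetric] suminf_add[OF 1 2])
  also have "(\<Sum>i. d (Suc i) * (?x (Suc i) * ?y (Suc i))) = (\<Sum>i. d i * (?x i * ?y i))"
    using suminf_split_head[of "\<lambda>i. d i * (?x i * ?y i)"] 2 boundary
    by (simp add: summable_Suc_iff[of "\<lambda>i. d i * (?x i * ?y i)"])
  also have "(\<Sum>i. ?y (Suc i) * ?x (Suc (Suc i))) = (\<Sum>i. ?y i * ?x (Suc i))"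
    using suminf_split_head[of "\<lambda>i. ?y i * ?x (Suc i)"] 3 boundary
    by (simp add: summable_Suc_iff[of "\<lambda>i. ?y i * ?x (Suc i)"])
  finally show ?thesis .
qed

text \<open>This is where the symmetry of the matrix enters.\<close>

lemma row_product_shift: "row_product m (Suc n) = row_product (Suc m) n"
proof -
  have "row_product m (Suc n) = row_product n (Suc m)"
    unfolding row_product_backward by (simp add: mult.commute)
  then show ?thesis
    by (simp add: row_product_def mult.commute)
qed

text \<open>
  The middle inner product equals the one of the two outer rows, so this is the Cauchy--Schwarz
  inequality for rows \<open>n\<close> and \<open>n + 2\<close>, in the form in which the scalar \<open>t\<close> is not yet optimised.
\<close>

lemma row_product_log_convex:
  "2 * t * row_product (Suc n) (Suc n) \<le> row_product n n + t\<^sup>2 * row_product (Suc (Suc n)) (Suc (Suc n))"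
proof -
  let ?x = "a n" and ?y = "a (Suc (Suc n))"
  have "2 * t * row_product (Suc n) (Suc n) = (\<Sum>i. 2 * t * (?x i * ?y i))"
    unfolding row_product_shift[of n "Suc n", symmetric]
    by (simp only: row_product_def suminf_mult[OF summable_row_product])
  also have "\<dots> \<le> (\<Sum>i. ?x i * ?x i + t\<^sup>2 * (?y i * ?y i))"
  proof (rule suminf_le)
    show "2 * t * (?x i * ?y i) \<le> ?x i * ?x i + t\<^sup>2 * (?y i * ?y i)" for i
      using zero_le_power2[of "?x i - t * ?y i"] by (simp add: power2_eq_square algebra_simps)
  qed (intro summable_add summable_mult summable_row_product)+
  also have "\<dots> = row_product n n + t\<^sup>2 * row_product (Suc (Suc n)) (Suc (Suc n))"
    by (simp add: row_product_def suminf_add[symmetric] suminf_mult summable_mult summable_row_product)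
  finally show ?thesis .
qed

text \<open>By log-convexity the ratios of successive squared norms increase, so none is below the first.\<close>

lemma row_product_lower:
  assumes r: "0 < r" "row_product 1 1 = r * row_product 0 0"
  shows "r ^ n * row_product 0 0 \<le> row_product n n"
proof -
  have step: "r * row_product n n \<le> row_product (Suc n) (Suc n)" for n
  proof (induction n)
    case 0 then show ?case using r by simp
  next
    case (Suc n)
    \<comment> \<open>\<open>t = 1 / r\<close> is the optimal choice when the squared norms are geometric with ratio \<open>r\<close>.\<close>
    have "2 * (1 / r) * row_product (Suc n) (Suc n)
        \<le> row_product n n + (1 / r)\<^sup>2 * row_product (Suc (Suc n)) (Suc (Suc n))"
      by (rule row_product_log_convex)
    then have "r\<^sup>2 * (2 * (1 / r) * row_product (Suc n) (Suc n))
        \<le> r\<^sup>2 * (row_product n n + (1 / r)\<^sup>2 * row_product (Suc (Suc n)) (Suc (Suc n)))"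
      by (intro mult_left_mono) auto
    moreover have "r\<^sup>2 * (2 * (1 / r) * u) = 2 * (r * u)"
      "r\<^sup>2 * (u + (1 / r)\<^sup>2 * v) = r * (r * u) + v" for u v
      using r(1) by (simp_all add: power2_eq_square distrib_left)
    ultimately have "2 * (r * row_product (Suc n) (Suc n))
        \<le> r * (r * row_product n n) + row_product (Suc (Suc n)) (Suc (Suc n))"
      by (simp only:)
    moreover have "r * (r * row_product n n) \<le> r * row_product (Suc n) (Suc n)"
      using Suc r(1) by (intro mult_left_mono) auto
    ultimately show ?case by linarith
  qed
  show ?thesis
  proof (induction n)
    case (Suc n)
    have "r * (r ^ n * row_product 0 0) \<le> r * row_product n n"
      using Suc r(1) by (intro mult_left_mono) auto
    with step[of n] show ?case by (simp add: mult_ac)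
  qed simp
qed

text \<open>
  Of the \<open>n + k\<close> steps down to level 0, the first \<open>k\<close> move the index to the right, past all small
  diagonal entries; each of the other \<open>n\<close> gains a factor \<open>R\<close> from the diagonal.
\<close>

lemma row_product_upper:
  assumes "0 \<le> R" "\<And>j. k \<le> j \<Longrightarrow> R \<le> d j"
  shows "(R\<^sup>2) ^ n * row_product (n + k) (n + k) \<le> row_product 0 0"
proof -
  have pt: "R ^ n * a (n + k) i \<le> a 0 (i + k)" for i
    using diag_power_le[of R "i + k" n] assms mult_left_mono[OF shift_le[of n k i], of "R ^ n"]
    by force
  have sq: "summable (\<lambda>i. a 0 (i + k) * a 0 (i + k))"
    using summable_row_product[of 0 0] summable_iff_shift[of "\<lambda>i. a 0 i * a 0 i" k] by simp
  have "(R\<^sup>2) ^ n * row_product (n + k) (n + k) = (\<Sum>i. (R\<^sup>2) ^ n * (a (n + k) i * a (n + k) i))"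
    by (simp only: row_product_def suminf_mult[OF summable_row_product])
  also have "\<dots> \<le> (\<Sum>i. a 0 (i + k) * a 0 (i + k))"
  proof (rule suminf_le)
    show "(R\<^sup>2) ^ n * (a (n + k) i * a (n + k) i) \<le> a 0 (i + k) * a 0 (i + k)" for i
      using mult_mono[OF pt[of i] pt[of i]] nonneg assms(1)
      by (simp add: power2_eq_square power_mult_distrib mult_ac)
  qed (intro summable_mult summable_row_product sq)+
  also have "\<dots> \<le> (\<Sum>i. a 0 (i + k) * a 0 (i + k)) + (\<Sum>i<k. a 0 i * a 0 i)"
    by (simp add: sum_nonneg)
  also have "\<dots> = row_product 0 0"
    unfolding row_product_def
    using suminf_split_initial_segment[OF summable_row_product[of 0 0], of k] by simp
  finally show ?thesis .
qed

lemma row_product_pos_iff: "0 < row_product n n \<longleftrightarrow> (\<exists>i. a n i \<noteq> 0)"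
  unfolding row_product_def
  using suminf_pos_iff[OF summable_row_product[of n n]] nonneg
  by (auto simp: zero_less_mult_iff less_le)

theorem start_eq_0: "a 0 i = 0"
proof (rule ccontr)
  assume nz: "a 0 i \<noteq> 0"
  have "\<exists>j. a 1 j \<noteq> 0"
  proof (rule ccontr)
    assume "\<nexists>j. a 1 j \<noteq> 0"
    then have "a 0 i = 0"
      using backward[of 0 "i - 1"] boundary[of 0] by (cases i) auto
    with nz show False ..
  qed
  then have pos: "0 < row_product 1 1" "0 < row_product 0 0"
    using nz row_product_pos_iff by blast+
  define r where "r = row_product 1 1 / row_product 0 0"
  have r: "0 < r" "row_product 1 1 = r * row_product 0 0"
    using pos by (simp_all add: r_def)
  \<comment> \<open>Any \<open>R\<close> with \<open>r * R\<^sup>2 > 1\<close> makes the two bounds on the squared norms incompatible.\<close>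
  define R where "R = sqrt (2 / r)"
  have R: "0 \<le> R" "R\<^sup>2 = 2 / r"
    using r(1) by (simp_all add: R_def)
  obtain k where k: "\<And>j. k \<le> j \<Longrightarrow> R \<le> d j"
    using diag_tends unfolding filterlim_at_top eventually_sequentially by blast
  have bound: "2 ^ n * r ^ k \<le> 1" for n
  proof -
    have "(R\<^sup>2) ^ n * (r ^ (n + k) * row_product 0 0) \<le> (R\<^sup>2) ^ n * row_product (n + k) (n + k)"
      using row_product_lower[OF r] by (intro mult_left_mono) auto
    also have "\<dots> \<le> row_product 0 0"
      using row_product_upper[OF R(1)] k by blast
    finally have "2 ^ n * r ^ k * row_product 0 0 \<le> 1 * row_product 0 0"
      using r(1) by (simp add: R(2) power_add power_divide)
    then show ?thesis
      using pos(2) by (simp only: mult_le_cancel_right_pos)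
  qed
  obtain n where "1 / r ^ k < 2 ^ n"
    using real_arch_pow[of 2 "1 / r ^ k"] by auto
  with bound[of n] r(1) show False
    by (simp add: divide_less_eq)
qed

end


section \<open>Cylinder sets\<close>

lemma path_borel_space: "space (path_borel B) = path_space B"
  unfolding path_borel_def by (rule space_measure_of_conv)

lemma cylinder_in_path_borel:
  assumes "finite_path B p"
  shows "cylinder B p \<in> sets (path_borel B)"
proof -
  have "openin (path_topology B) (cylinder B p)"
    unfolding path_topology_def
    using assms by (intro topology_generated_by_Basis) blast
  moreover have "{U. openin (path_topology B) U} \<subseteq> Pow (path_space B)"
    using openin_subset[of "path_topology B"] by (auto simp: topspace_path_topology)
  ultimately show ?thesis
    unfolding path_borel_def by (simp add: sigma_sets.Basic)
qed

lemma finite_path_snoc: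
  assumes "finite_path B p" "e \<in> edges B (length p)"
    "src B (length p) e = snd (path_range B p)"
  shows "finite_path B (p @ [e])"
proof -
  have "rng B i ((p @ [e]) ! i) = src B (Suc i) ((p @ [e]) ! Suc i)" if "Suc i < length (p @ [e])" for i
  proof (cases "Suc i < length p")
    case True
    then show ?thesis using assms(1) by (simp add: finite_path_def nth_append)
  next
    case False
    with that have "length p = Suc i" by simp
    moreover from this have "p ! i = last p"
      by (metis diff_Suc_1 last_conv_nth length_0_conv nat.distinct(1))
    ultimately show ?thesis
      using assms(3) by (simp add: nth_append path_range_def)
  qed
  then show ?thesis
    using assms(1,2) by (auto simp: finite_path_def nth_append less_Suc_eq)
qed

lemma cylinder_eq_UN_snoc:
  assumes "finite_path B p"
  shows "cylinder B p =
    (\<Union>e\<in>{e \<in> edges B (length p). src B (length p) e = snd (path_range B p)}. cylinder B (p @ [e]))"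
proof (intro equalityI subsetI)
  fix x assume x: "x \<in> cylinder B p"
  have ne: "p \<noteq> []" using assms by (simp add: finite_path_def)
  then have "p ! (length p - 1) = last p" by (simp add: last_conv_nth)
  moreover have "x (length p - 1) = p ! (length p - 1)"
    using x ne by (simp add: cylinder_def)
  moreover have "rng B (length p - 1) (x (length p - 1)) = src B (length p) (x (length p))"
    using x ne by (auto simp: cylinder_def path_space_def dest: spec[of _ "length p - 1"])
  ultimately have "src B (length p) (x (length p)) = snd (path_range B p)"
    by (simp add: path_range_def)
  moreover have "x (length p) \<in> edges B (length p)"
    using x by (simp add: cylinder_def path_space_def)
  moreover have "x \<in> cylinder B (p @ [x (length p)])"
    using x by (auto simp: cylinder_def nth_append less_Suc_eq)
  ultimately show "x \<in> (\<Union>e\<in>{e \<in> edges B (length p).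
      src B (length p) e = snd (path_range B p)}. cylinder B (p @ [e]))" by blast
qed (auto simp: cylinder_def nth_append split: if_splits)

lemma disjoint_cylinder_snoc: "disjoint_family_on (\<lambda>e. cylinder B (p @ [e])) S"
proof -
  have "x (length p) = e" if "x \<in> cylinder B (p @ [e])" for x e
    using that by (auto simp: cylinder_def dest: spec[of _ "length p"])
  then show ?thesis
    unfolding disjoint_family_on_def by (metis IntE equals0I)
qed


section \<open>Masses of vertices under a tail invariant measure\<close>

context
  fixes B :: "(nat, 'e) diagram"
  assumes stat: "is_stationary_diagram B tridiag"
begin

lemma vertex_pos: "e \<in> edges B n \<Longrightarrow> 1 \<le> src B n e \<and> 1 \<le> rng B n e"
  using stat by (auto simp: is_stationary_diagram_def generalized_bratteli_def)

lemma finite_in_edges: "1 \<le> v \<Longrightarrow> finite {e \<in> edges B n. rng B n e = v}"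
  using stat by (auto simp: is_stationary_diagram_def generalized_bratteli_def)

lemma edges_between:
  assumes "1 \<le> v" "1 \<le> w"
  shows "finite {e \<in> edges B n. src B n e = w \<and> rng B n e = v}"
    and "card {e \<in> edges B n. src B n e = w \<and> rng B n e = v} = tridiag v w"
proof -
  show "finite {e \<in> edges B n. src B n e = w \<and> rng B n e = v}"
    by (rule finite_subset[OF _ finite_in_edges[OF assms(1)]]) auto
  show "card {e \<in> edges B n. src B n e = w \<and> rng B n e = v} = tridiag v w"
    using stat assms by (auto simp: is_stationary_diagram_def incidence_def)
qed

definition loop_at :: "nat \<Rightarrow> nat \<Rightarrow> 'e" where
  "loop_at n v = (SOME e. e \<in> edges B n \<and> src B n e = v \<and> rng B n e = v)"

lemma loop_at:
  assumes "1 \<le> v"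
  shows "loop_at n v \<in> edges B n" "src B n (loop_at n v) = v" "rng B n (loop_at n v) = v"
proof -
  have "card {e \<in> edges B n. src B n e = v \<and> rng B n e = v} \<noteq> 0"
    using edges_between(2)[OF assms assms] by (simp add: tridiag_def)
  then have "{e \<in> edges B n. src B n e = v \<and> rng B n e = v} \<noteq> {}"
    by (metis card.empty)
  then have "\<exists>e. e \<in> edges B n \<and> src B n e = v \<and> rng B n e = v" by blast
  from someI_ex[OF this] show "loop_at n v \<in> edges B n" "src B n (loop_at n v) = v" "rng B n (loop_at n v) = v"
    by (simp_all add: loop_at_def)
qed

text \<open>
  By tail invariance any path may represent its end vertex; the one that stays at the same vertex
  at all levels exists because the diagonal of the matrix is positive.
\<close>

definition vertical_path :: "nat \<Rightarrow> nat \<Rightarrow> 'e list" where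
  "vertical_path n v = map (\<lambda>i. loop_at i v) [0..<Suc n]"

lemma vertical_path:
  assumes "1 \<le> v"
  shows "finite_path B (vertical_path n v)" "path_range B (vertical_path n v) = (Suc n, v)"
  using loop_at[OF assms]
  by (auto simp: finite_path_def path_range_def vertical_path_def nth_append less_Suc_eq simp del: upt_Suc)
     (simp_all add: last_map)

text \<open>Positive integers are the vertices; the value at 0 is the boundary value of the Jacobi matrix.\<close>

definition vertex_mass :: "(nat \<Rightarrow> 'e) measure \<Rightarrow> nat \<Rightarrow> nat \<Rightarrow> real" where
  "vertex_mass \<mu> n v = (if v = 0 then 0 else measure \<mu> (cylinder B (vertical_path n v)))"

text \<open>
  The matrix is banded, so finitely many edges leave each vertex. This makes the splitting of a
  cylinder by its next edge a finite sum.
\<close>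

lemma out_edges:
  assumes "1 \<le> w"
  shows "{e \<in> edges B n. src B n e = w} =
    (\<Union>v\<in>{v. 1 \<le> v \<and> v \<le> Suc w \<and> w \<le> Suc v}. {e \<in> edges B n. src B n e = w \<and> rng B n e = v})"
proof -
  have "rng B n e \<le> Suc w \<and> w \<le> Suc (rng B n e)" if e: "e \<in> edges B n" "src B n e = w" for e
  proof (rule ccontr)
    let ?v = "rng B n e"
    assume "\<not> (?v \<le> Suc w \<and> w \<le> Suc ?v)"
    then have "tridiag ?v w = 0" by (auto simp: tridiag_def)
    then have "{e \<in> edges B n. src B n e = w \<and> rng B n e = ?v} = {}"
      using edges_between[of ?v w n] vertex_pos[OF e(1)] assms by simp
    with e show False by blast
  qed
  then show ?thesis using vertex_pos by blast
qed

context
  fixes \<mu> :: "(nat \<Rightarrow> 'e) measure"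
  assumes prob: "prob_space \<mu>" and inv: "tail_invariant B \<mu>"
begin

interpretation prob_space \<mu> by (rule prob)

lemma sets_\<mu>: "sets \<mu> = sets (path_borel B)"
  using inv by (simp add: tail_invariant_def)

lemma space_\<mu>: "space \<mu> = path_space B"
  using sets_eq_imp_space_eq[OF sets_\<mu>] path_borel_space by metis

lemma cylinder_event: "finite_path B p \<Longrightarrow> cylinder B p \<in> events"
  using cylinder_in_path_borel sets_\<mu> by simp

lemma cylinder_prob:
  assumes "finite_path B p" "path_range B p = (Suc n, v)" "1 \<le> v"
  shows "prob (cylinder B p) = vertex_mass \<mu> n v"
proof -
  have "emeasure \<mu> (cylinder B p) = emeasure \<mu> (cylinder B (vertical_path n v))"
    using inv assms vertical_path[OF assms(3), of n] unfolding tail_invariant_def by metis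
  with assms(3) show ?thesis
    by (simp add: vertex_mass_def measure_def)
qed

lemma vertex_mass_eq_sum:
  assumes w: "1 \<le> w"
  shows "vertex_mass \<mu> n w =
    (\<Sum>v | 1 \<le> v \<and> v \<le> Suc w \<and> w \<le> Suc v. real (tridiag v w) * vertex_mass \<mu> (Suc n) v)"
proof -
  let ?p = "vertical_path n w"
  let ?V = "{v. 1 \<le> v \<and> v \<le> Suc w \<and> w \<le> Suc v}"
  let ?E = "\<lambda>v. {e \<in> edges B (Suc n). src B (Suc n) e = w \<and> rng B (Suc n) e = v}"
  have len: "length ?p = Suc n" by (simp add: vertical_path_def)
  note p = vertical_path[OF w, of n]
  have path: "finite_path B (?p @ [e])" if "e \<in> ?E v" for v e
    using that p len by (intro finite_path_snoc) auto
  have finV: "finite ?V" by (rule finite_subset[of _ "{..Suc w}"]) auto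
  have finE: "finite (?E v)" if "v \<in> ?V" for v
    using that w edges_between(1) by simp
  have "vertex_mass \<mu> n w = prob (cylinder B ?p)"
    using w by (simp add: vertex_mass_def)
  also have "cylinder B ?p = (\<Union>e\<in>(\<Union>v\<in>?V. ?E v). cylinder B (?p @ [e]))"
    unfolding out_edges[OF w, of "Suc n", symmetric]
    using cylinder_eq_UN_snoc[OF p(1)] by (simp add: p(2) len)
  also have "prob \<dots> = (\<Sum>e\<in>(\<Union>v\<in>?V. ?E v). prob (cylinder B (?p @ [e])))"
    using finV finE path
    by (intro finite_measure_finite_Union disjoint_cylinder_snoc) (auto intro!: cylinder_event)
  also have "\<dots> = (\<Sum>v\<in>?V. \<Sum>e\<in>?E v. prob (cylinder B (?p @ [e])))"
    using finV finE by (intro sum.UNION_disjoint) auto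
  also have "\<dots> = (\<Sum>v\<in>?V. \<Sum>e\<in>?E v. vertex_mass \<mu> (Suc n) v)"
    by (intro sum.cong refl cylinder_prob path) (auto simp: path_range_def len)
  also have "\<dots> = (\<Sum>v\<in>?V. real (tridiag v w) * vertex_mass \<mu> (Suc n) v)"
    using w by (intro sum.cong) (auto simp: edges_between(2))
  finally show ?thesis .
qed

lemma vertex_mass_backward:
  "vertex_mass \<mu> n (Suc i) = vertex_mass \<mu> (Suc n) i +
     real (Suc (Suc i)) * vertex_mass \<mu> (Suc n) (Suc i) + vertex_mass \<mu> (Suc n) (Suc (Suc i))"
proof -
  have sum: "vertex_mass \<mu> n (Suc i) = (\<Sum>v\<in>V. real (tridiag v (Suc i)) * vertex_mass \<mu> (Suc n) v)"
    if "{v. 1 \<le> v \<and> v \<le> Suc (Suc i) \<and> Suc i \<le> Suc v} = V" for V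
    unfolding that[symmetric] by (rule vertex_mass_eq_sum) simp
  show ?thesis
  proof (cases "i = 0")
    case True
    then have "{v. 1 \<le> v \<and> v \<le> Suc (Suc i) \<and> Suc i \<le> Suc v} = {Suc i, Suc (Suc i)}"
      by auto
    from sum[OF this] True show ?thesis
      by (simp add: tridiag_def vertex_mass_def[of _ _ 0])
  next
    case False
    then have "{v. 1 \<le> v \<and> v \<le> Suc (Suc i) \<and> Suc i \<le> Suc v} = {i, Suc i, Suc (Suc i)}"
      by auto
    from sum[OF this] show ?thesis
      by (simp add: tridiag_def)
  qed
qed

text \<open>The loops at level 0 have distinct sources, so their cylinders are disjoint.\<close>

lemma summable_vertex_mass: "summable (vertex_mass \<mu> 0)"
proof -
  let ?A = "\<lambda>v. if v = 0 then {} else cylinder B (vertical_path 0 v)"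
  have "disjoint_family ?A"
  proof (unfold disjoint_family_on_def, intro ballI impI)
    fix v w :: nat assume "v \<noteq> w"
    then show "?A v \<inter> ?A w = {}"
      using loop_at(2)[of v 0] loop_at(2)[of w 0] by (auto simp: cylinder_def vertical_path_def)
  qed
  moreover have "range ?A \<subseteq> events"
    using vertical_path(1) by (auto intro!: cylinder_event)
  ultimately have "(\<lambda>v. prob (?A v)) sums prob (\<Union>v. ?A v)"
    by (intro finite_measure_UNION)
  moreover have "(\<lambda>v. prob (?A v)) = vertex_mass \<mu> 0"
    by (auto simp: vertex_mass_def)
  ultimately show ?thesis by (simp only: sums_summable)
qed

text \<open>There are only countably many edges at level 0, as finitely many of them end at each vertex.\<close>

lemma vertex_mass_nontrivial: "\<exists>v. vertex_mass \<mu> 0 v \<noteq> 0"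
proof (rule ccontr)
  assume zero: "\<nexists>v. vertex_mass \<mu> 0 v \<noteq> 0"
  have "countable (\<Union>v\<in>{1..}. {e \<in> edges B 0. rng B 0 e = v})"
    by (intro countable_UN countableI_type countable_finite finite_in_edges) simp
  moreover have "(\<Union>v\<in>{1..}. {e \<in> edges B 0. rng B 0 e = v}) = edges B 0"
    using vertex_pos by auto
  ultimately have "countable (edges B 0)" by (simp only:)
  moreover have "cylinder B [e] \<in> null_sets \<mu>" if e: "e \<in> edges B 0" for e
  proof -
    have path: "finite_path B [e]" using e by (simp add: finite_path_def)
    have "prob (cylinder B [e]) = vertex_mass \<mu> 0 (rng B 0 e)"
      using path vertex_pos[OF e] by (intro cylinder_prob) (auto simp: path_range_def)
    with zero path show ?thesis
      by (auto intro!: null_setsI cylinder_event simp: emeasure_eq_measure)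
  qed
  ultimately have "(\<Union>e\<in>edges B 0. cylinder B [e]) \<in> null_sets \<mu>"
    by (rule null_sets_UN')
  moreover have "(\<Union>e\<in>edges B 0. cylinder B [e]) = space \<mu>"
    by (auto simp: space_\<mu> cylinder_def path_space_def)
  ultimately show False
    using emeasure_space_1 by (auto simp: null_sets_def)
qed

lemma vertex_mass_orbit: "jacobi_backward_orbit (\<lambda>i. real (Suc i)) (vertex_mass \<mu>)"
proof
  show "filterlim (\<lambda>i. real (Suc i)) at_top sequentially"
    by (rule filterlim_compose[OF filterlim_real_sequentially filterlim_Suc])
  show "vertex_mass \<mu> n (Suc i) = vertex_mass \<mu> (Suc n) i +
      real (Suc (Suc i)) * vertex_mass \<mu> (Suc n) (Suc i) + vertex_mass \<mu> (Suc n) (Suc (Suc i))" for n i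
    by (rule vertex_mass_backward)
  show "summable (vertex_mass \<mu> 0)"
    by (rule summable_vertex_mass)
qed (simp_all add: vertex_mass_def)

end

end

theorem theorem4p4:
  fixes B :: "(nat, 'e) diagram"
  assumes "is_stationary_diagram B tridiag"
  shows "\<not> (\<exists>\<mu>. prob_space \<mu> \<and> tail_invariant B \<mu>)"
proof
  assume "\<exists>\<mu>. prob_space \<mu> \<and> tail_invariant B \<mu>"
  then obtain \<mu> where \<mu>: "prob_space \<mu>" "tail_invariant B \<mu>" by blast
  from vertex_mass_nontrivial[OF assms \<mu>] jacobi_backward_orbit.start_eq_0[OF vertex_mass_orbit[OF assms \<mu>]]
  show False by blast
qed

end
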